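(* For every $1<p<\infty$, the tube maximal operator $M_{tube}$, $$M_{tube}(f)(\mathbf x)=\sup_{\mathbf r\in\mathbb R^3_+}\frac1{|T(\mathbf x,\mathbf r)|}\int_{T(\mathbf x,\mathbf r)}|f(\mathbf y)|\,d\mathbf y ,$$ is bounded from $L^p(\mathbb R^{2m})$ to $L^p(\mathbb R^{2m})$.
   Context: Let $m\ge 1$ be an integer, $\mathbb R^{2m}=\mathbb R^m\times\mathbb R^m$ with points $\mathbf x=(x_1,x_2)$, and $\mathbb R^3_+=(0,\infty)^3$. For $\mathbf r=(r_1,r_2,r_3)\in\mathbb R^3_+$ the tube $T(\mathbf 0,\mathbf r)\subset\mathbb R^{2m}$ is defined by (using the first case that applies): (i) if $r_1,r_2\ge r_3$: $T(\mathbf 0,\mathbf r)=\{(x_1,x_2):|x_1|<r_1,\ |x_2|<r_2\}$; (ii) if $r_1,r_3\ge r_2$: $T(\mathbf 0,\mathbf r)=\{(x_1,x_2):|x_1-x_2|<r_1,\ |x_2|<r_3\}$; (iii) if $r_2,r_3\ge r_1$: $T(\mathbf 0,\mathbf r)=\{(x_1,x_2):|x_2-x_1|<r_2,\ |x_1|<r_3\}$. For $\mathbf x\in\mathbb R^{2m}$, $T(\mathbf x,\mathbf r)=\mathbf x+T(\mathbf 0,\mathbf r)$. $|E|$ denotes Lebesgue measure of a set $E$. *)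

theory Defs
  imports "HOL-Analysis.Analysis"
begin

definition pos_triples :: "(real \<times> real \<times> real) set" where
  "pos_triples = {0<..} \<times> {0<..} \<times> {0<..}"

(* The final branch is the case r2, r3 >= r1, which always holds when the first two conditions fail. *)
fun tube0 :: "real \<times> real \<times> real \<Rightarrow> ((real ^ 'm) \<times> (real ^ 'm)) set" where
  "tube0 (r1, r2, r3) =
     (if r1 \<ge> r3 \<and> r2 \<ge> r3 then {(x1, x2). norm x1 < r1 \<and> norm x2 < r2}
      else if r1 \<ge> r2 \<and> r3 \<ge> r2 then {(x1, x2). norm (x1 - x2) < r1 \<and> norm x2 < r3}
      else {(x1, x2). norm (x2 - x1) < r2 \<and> norm x1 < r3})"

definition tube :: "(real ^ 'm) \<times> (real ^ 'm) \<Rightarrow> real \<times> real \<times> real \<Rightarrow> ((real ^ 'm) \<times> (real ^ 'm)) set" where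
  "tube x r = (+) x ` tube0 r"

(* Extended-real valued: the supremum of averages may be infinite. *)
definition M_tube :: "((real ^ 'm) \<times> (real ^ 'm) \<Rightarrow> complex) \<Rightarrow> (real ^ 'm) \<times> (real ^ 'm) \<Rightarrow> ennreal" where
  "M_tube f x = (SUP r\<in>pos_triples.
     (\<integral>\<^sup>+y\<in>tube x r. ennreal (norm (f y)) \<partial>lebesgue) / emeasure lebesgue (tube x r))"

(* Real powers of extended nonnegative reals, meant for positive exponents. *)
definition ennreal_pow :: "ennreal \<Rightarrow> real \<Rightarrow> ennreal" where
  "ennreal_pow a p = (if a = \<infinity> then \<infinity> else ennreal (enn2real a powr p))"

definition Lp_norm :: "real \<Rightarrow> ('a::euclidean_space \<Rightarrow> ennreal) \<Rightarrow> ennreal" where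
  "Lp_norm p g = ennreal_pow (\<integral>\<^sup>+x. ennreal_pow (g x) p \<partial>lebesgue) (1 / p)"

definition Lp_space :: "real \<Rightarrow> ('a::euclidean_space \<Rightarrow> complex) set" where
  "Lp_space p = {f. f \<in> borel_measurable lebesgue \<and> Lp_norm p (\<lambda>x. ennreal (norm (f x))) < \<infinity>}"

end

theory Submission
  imports Defs
begin

text \<open>
  In each of its three cases the tube \<open>T(0, r)\<close> is the image of a product of two balls under a
  measure-preserving shear (the identity, \<open>(u, v) \<mapsto> (u + v, v)\<close> or \<open>(u, v) \<mapsto> (u, u + v)\<close>). Hence the
  tube maximal function is bounded by the largest of three strong maximal functions conjugated by
  shears. A strong maximal function is dominated by two iterated Hardy--Littlewood maximal
  functions, whose bounds follow from Vitali covering (weak type) and the layer-cake formula.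
  Measurability of the uncountable supremum holds because averages over translates of an open set
  are lower semicontinuous.
\<close>

text \<open>Every estimate concerns Borel functions with values in \<open>ennreal\<close> under
  \<open>lborel\<close>, so Tonelli, Fatou and the layer-cake formula need no integrability. The
  given \<open>f\<close> is only Lebesgue measurable, and slices of such a function may fail to be
  measurable; a Borel function equal to its norm almost everywhere takes its place, which changes no
  average.

  Products of balls with independent radii can be arbitrarily eccentric, so a covering argument of
  Vitali type does not apply to them directly; this is why operators in one variable are iterated.
  The iteration requires the inner maximal function to be jointly measurable in the slice and the
  point, which semicontinuity in the point alone would not give. The supremum over tubes involves no
  slices, so semicontinuity settles its measurability.

  The shear that dominates at a point depends on the point. The p-th powers of all three strong
  maximal functions are therefore added, which puts a cardinality into the final constant.\<close>

lemma ennreal_pow_ennreal [simp]: "0 \<le> c \<Longrightarrow> ennreal_pow (ennreal c) p = ennreal (c powr p)"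
  by (simp add: ennreal_pow_def)

lemma ennreal_pow_0 [simp]: "ennreal_pow 0 p = 0"
  by (simp add: ennreal_pow_def)

lemma ennreal_pow_top [simp]: "ennreal_pow top p = top"
  by (simp add: ennreal_pow_def)

lemma ennreal_pow_mono:
  assumes "a \<le> b" "0 \<le> p"
  shows "ennreal_pow a p \<le> ennreal_pow b p"
  using assms by (cases a; cases b) (auto intro!: ennreal_leI powr_mono2 simp: top_unique)

lemma ennreal_pow_cmult:
  assumes "0 \<le> c" "0 < p"
  shows "ennreal_pow (ennreal c * a) p = ennreal (c powr p) * ennreal_pow a p"
  using assms
  by (cases a; cases "c = 0") (auto simp: ennreal_mult[symmetric] powr_mult ennreal_mult_top)

lemma mult_ennreal_pow:
  assumes "1 < p"
  shows "a * ennreal_pow a (p - 1) = ennreal_pow a p"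
proof (cases a)
  case (real c)
  then show ?thesis
    using assms by (cases "c = 0") (auto simp: ennreal_mult[symmetric] powr_diff)
qed auto

lemma borel_measurable_ennreal_pow [measurable]:
  assumes [measurable]: "f \<in> borel_measurable M"
  shows "(\<lambda>x. ennreal_pow (f x) p) \<in> borel_measurable M"
  unfolding ennreal_pow_def by measurable

section \<open>The layer-cake formula\<close>

lemma ennreal_eq_topI:
  assumes "\<And>x. 0 \<le> x \<Longrightarrow> ennreal x \<le> a"
  shows "a = top"
proof (cases a)
  case (real r)
  then show ?thesis
    using assms[of "r + 1"] by simp
qed

text \<open>The layer-cake formula at a single point: the derivative of l^q is integrated from 0 to
  \<open>a\<close>. The condition \<open>0 < l\<close> matters because \<open>ennreal\<close> sends
  negative reals to 0.\<close>

lemma nn_integral_powr_less: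
  assumes "0 < q"
  shows "(\<integral>\<^sup>+l. ennreal (q * l powr (q - 1)) * indicator {l. 0 < l \<and> ennreal l < a} l \<partial>lborel)
           = ennreal_pow a q"
proof -
  have fin: "(\<integral>\<^sup>+l. ennreal (q * l powr (q - 1)) * indicator {0..c} l \<partial>lborel) = ennreal (c powr q)"
    if "0 \<le> c" for c
  proof -
    have "((\<lambda>l. q * l powr (q - 1)) has_integral q * (c powr (q - 1 + 1) / (q - 1 + 1))) {0..c}"
      using assms that by (intro has_integral_mult_right has_integral_powr_from_0) auto
    then show ?thesis
      using assms by (intro nn_integral_has_integral_lebesgue') auto
  qed
  \<comment> \<open>The power integral is known on the closed interval, while the layer set is open;
    the endpoints 0 and c form a null set.\<close>
  have ae: "AE l in lborel. l \<noteq> (c::real)" for c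
    by (simp add: AE_lborel_singleton)
  have less: "(\<integral>\<^sup>+l. ennreal (q * l powr (q - 1)) * indicator {l. 0 < l \<and> ennreal l < ennreal c} l \<partial>lborel)
           = ennreal (c powr q)" if "0 \<le> c" for c
    unfolding fin[OF that, symmetric]
    using ae[of c] ae[of 0]
    by (intro nn_integral_cong_AE, eventually_elim)
       (auto simp: indicator_def ennreal_less_iff that)
  show ?thesis
  proof (cases a)
    case (real c)
    then show ?thesis using less by auto
  next
    case top
    have "ennreal x \<le> (\<integral>\<^sup>+l. ennreal (q * l powr (q - 1)) * indicator {l. 0 < l \<and> ennreal l < top} l \<partial>lborel)"
      (is "_ \<le> ?I") if "0 \<le> x" for x
    proof -
      \<comment> \<open>The level x^(1/q) is chosen so that the layers below it already contribute
        exactly x; hence the full integral exceeds every real.\<close>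
      have "ennreal x = ennreal ((x powr (1 / q)) powr q)"
        using assms that by (simp add: powr_powr)
      also have "\<dots> = (\<integral>\<^sup>+l. ennreal (q * l powr (q - 1)) *
          indicator {l. 0 < l \<and> ennreal l < ennreal (x powr (1/q))} l \<partial>lborel)"
        by (rule less[symmetric]) simp
      also have "\<dots> \<le> ?I"
        by (intro nn_integral_mono mult_left_mono) (auto simp: indicator_def)
      finally show ?thesis .
    qed
    then show ?thesis
      unfolding top ennreal_pow_top by (rule ennreal_eq_topI)
  qed
qed

text \<open>The weight serves the two uses in the strong type bound: \<open>w = 1\<close> with the
  maximal function and exponent p, then \<open>w = g\<close> with \<open>2 * g\<close> and exponent
  p - 1.\<close>

lemma nn_integral_mult_ennreal_pow:
  fixes h w :: "'a::euclidean_space \<Rightarrow> ennreal"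
  assumes [measurable]: "h \<in> borel_measurable borel" "w \<in> borel_measurable borel" and "0 < q"
  shows "(\<integral>\<^sup>+x. w x * ennreal_pow (h x) q \<partial>lborel) =
    (\<integral>\<^sup>+l. ennreal (q * l powr (q - 1)) * indicator {0<..} l *
       (\<integral>\<^sup>+x. w x * indicator {x. ennreal l < h x} x \<partial>lborel) \<partial>lborel)"
proof -
  have "(\<integral>\<^sup>+x. w x * ennreal_pow (h x) q \<partial>lborel) =
    (\<integral>\<^sup>+x. (\<integral>\<^sup>+l. w x * (ennreal (q * l powr (q - 1)) * indicator {l. 0 < l \<and> ennreal l < h x} l) \<partial>lborel) \<partial>lborel)"
    by (subst nn_integral_cmult) (auto simp: nn_integral_powr_less[OF \<open>0 < q\<close>])
  also have "\<dots> = (\<integral>\<^sup>+l. (\<integral>\<^sup>+x. w x * (ennreal (q * l powr (q - 1)) * indicator {l. 0 < l \<and> ennreal l < h x} l) \<partial>lborel) \<partial>lborel)"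
    by (rule lborel_pair.Fubini'[symmetric]) measurable
  also have "\<dots> = (\<integral>\<^sup>+l. (\<integral>\<^sup>+x. ennreal (q * l powr (q - 1)) * indicator {0<..} l * (w x * indicator {x. ennreal l < h x} x) \<partial>lborel) \<partial>lborel)"
    by (intro nn_integral_cong) (auto simp: indicator_def mult_ac)
  also have "\<dots> = (\<integral>\<^sup>+l. ennreal (q * l powr (q - 1)) * indicator {0<..} l *
       (\<integral>\<^sup>+x. w x * indicator {x. ennreal l < h x} x \<partial>lborel) \<partial>lborel)"
    by (intro nn_integral_cong nn_integral_cmult) measurable
  finally show ?thesis .
qed

section \<open>Averages and the Hardy-Littlewood maximal function\<close>

definition avg :: "'a::euclidean_space set \<Rightarrow> ('a \<Rightarrow> ennreal) \<Rightarrow> 'a \<Rightarrow> ennreal" where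
  "avg U g x = (\<integral>\<^sup>+y. g (x + y) * indicator U y \<partial>lborel) / emeasure lborel U"

text \<open>Rational radii make the supremum countable, so that joint measurability in a parameter is
  immediate; \<open>avg_ball_le_HL_max\<close> recovers all radii.\<close>
definition HL_max :: "('a::euclidean_space \<Rightarrow> ennreal) \<Rightarrow> 'a \<Rightarrow> ennreal" where
  "HL_max g x = (SUP r\<in>{r\<in>\<rat>. 0 < r}. avg (ball 0 r) g x)"

text \<open>The parameter \<open>s\<close> will be the other coordinate when maximal functions are
  iterated. Since \<open>avg\<close> translates the argument of \<open>g\<close> and keeps
  \<open>U\<close> fixed, joint measurability reduces to that of a parametrized integral.\<close>

lemma borel_measurable_avg:
  assumes g [measurable]: "(\<lambda>(s, x). g s x) \<in> borel_measurable (N \<Otimes>\<^sub>M borel)"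
    and [measurable]: "U \<in> sets borel"
  shows "(\<lambda>(s, x). avg U (g s) x) \<in> borel_measurable (N \<Otimes>\<^sub>M borel)"
  unfolding avg_def by measurable

lemma borel_measurable_HL_max_pair:
  assumes "(\<lambda>(s, x). g s x) \<in> borel_measurable (N \<Otimes>\<^sub>M borel)"
  shows "(\<lambda>(s, x). HL_max (g s) x) \<in> borel_measurable (N \<Otimes>\<^sub>M borel)"
proof -
  have "countable {r \<in> \<rat>. 0 < (r::real)}"
    by (rule countable_subset[OF _ countable_rat]) auto
  then show ?thesis
    unfolding HL_max_def split_beta
    using borel_measurable_avg[OF assms, unfolded split_beta]
    by (intro borel_measurable_SUP) auto
qed

lemma borel_measurable_HL_max [measurable]:
  assumes [measurable]: "g \<in> borel_measurable borel"
  shows "HL_max g \<in> borel_measurable borel"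
proof -
  \<comment> \<open>A one-point parameter space specializes the joint statement.\<close>
  have "(\<lambda>(s::unit, x). HL_max g x) \<in> borel_measurable (count_space UNIV \<Otimes>\<^sub>M borel)"
    by (rule borel_measurable_HL_max_pair) measurable
  from measurable_compose[OF measurable_Pair1'[of "()"] this] show ?thesis
    by simp
qed

lemma ball_in_sets_borel [measurable]: "ball (c::'a::euclidean_space) r \<in> sets borel"
  by simp

lemma emeasure_ball_pos_finite:
  assumes "0 < r"
  shows "emeasure lborel (ball (c::'a::euclidean_space) r) \<noteq> 0"
        "emeasure lborel (ball c r) < top"
proof -
  have "unit_ball_vol (real DIM('a)) \<noteq> 0"
    by (metis less_irrefl of_nat_0_le_iff unit_ball_vol_pos)
  then show "emeasure lborel (ball c r) \<noteq> 0" "emeasure lborel (ball c r) < top"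
    using assms by (auto simp: emeasure_ball)
qed

text \<open>An open ball is exhausted by concentric balls with rational radii tending to
  \<open>r\<close> from below. These radii need not increase, so Fatou is used in place of monotone
  convergence; shrinking the ball only lowers the volume by which the supremum is
  multiplied.\<close>

lemma avg_ball_le_HL_max:
  fixes g :: "'a::euclidean_space \<Rightarrow> ennreal"
  assumes [measurable]: "g \<in> borel_measurable borel" and "0 < r"
  shows "avg (ball 0 r) g x \<le> HL_max g x"
proof -
  have "\<exists>q\<in>\<rat>. max 0 (r - 1 / Suc n) < q \<and> q < r" for n
    using \<open>0 < r\<close> by (intro Rats_dense_in_real) auto
  then obtain q where q: "\<And>n. q n \<in> \<rat>" "\<And>n. 0 < q n" "\<And>n. r - 1 / Suc n < q n" "\<And>n. q n < r"
    by (metis max_less_iff_conj)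
  define u where "u n y = g (x + y) * indicator (ball 0 (q n)) y" for n y
  have [measurable]: "u n \<in> borel_measurable borel" for n
    unfolding u_def by measurable
  have "g (x + y) * indicator (ball 0 r) y \<le> liminf (\<lambda>n. u n y)" for y
  proof (cases "norm y < r")
    case True
    obtain N where N: "inverse (real (Suc N)) < r - norm y"
      using reals_Archimedean[of "r - norm y"] True by auto
    have "norm y < q n" if "N \<le> n" for n
    proof -
      have "1 / real (Suc n) \<le> inverse (real (Suc N))"
        using that by (simp add: field_simps)
      then show ?thesis
        using N q(3)[of n] by linarith
    qed
    then show ?thesis
      using True by (intro Liminf_bounded eventually_sequentiallyI[of N]) (auto simp: u_def)
  qed auto
  then have "(\<integral>\<^sup>+y. g (x + y) * indicator (ball 0 r) y \<partial>lborel) \<le> (\<integral>\<^sup>+y. liminf (\<lambda>n. u n y) \<partial>lborel)"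
    by (intro nn_integral_mono)
  also have "\<dots> \<le> liminf (\<lambda>n. \<integral>\<^sup>+y. u n y \<partial>lborel)"
    by (intro nn_integral_liminf) auto
  also have "\<dots> \<le> HL_max g x * emeasure lborel (ball (0::'a) r)"
  proof (intro Liminf_le always_eventually allI)
    fix n
    have "(\<integral>\<^sup>+y. u n y \<partial>lborel) = avg (ball 0 (q n)) g x * emeasure lborel (ball (0::'a) (q n))"
      using emeasure_ball_pos_finite[of "q n" "0::'a"] q[of n] unfolding avg_def u_def
      by (simp add: ennreal_divide_times ennreal_divide_self)
    also have "\<dots> \<le> HL_max g x * emeasure lborel (ball (0::'a) r)"
      using q(1,2)[of n] q(4)[of n, THEN less_imp_le] unfolding HL_max_def
      by (intro mult_mono SUP_upper emeasure_mono) auto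
    finally show "(\<integral>\<^sup>+y. u n y \<partial>lborel) \<le> HL_max g x * emeasure lborel (ball (0::'a) r)" .
  qed simp
  finally show ?thesis
    using emeasure_ball_pos_finite[OF \<open>0 < r\<close>, of "0::'a"] unfolding avg_def
    by (intro divide_le_posI_ennreal) (auto simp: mult.commute pos2 zero_less_iff_neq_zero)
qed

section \<open>The weak type bound by Vitali covering\<close>

lemma emeasure_UN_le_countable:
  assumes [measurable]: "\<And>i. i \<in> I \<Longrightarrow> X i \<in> sets M" and "countable I"
  shows "emeasure M (\<Union>i\<in>I. X i) \<le> (\<integral>\<^sup>+i. emeasure M (X i) \<partial>count_space I)"
proof -
  have "(\<Union>i\<in>I. X i) \<in> sets M"
    using assms by auto
  then have "emeasure M (\<Union>i\<in>I. X i) = (\<integral>\<^sup>+x. indicator (\<Union>i\<in>I. X i) x \<partial>M)"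
    by simp
  also have "\<dots> \<le> (\<integral>\<^sup>+x. \<integral>\<^sup>+i. indicator (X i) x \<partial>count_space I \<partial>M)"
  proof (intro nn_integral_mono)
    fix x
    show "indicator (\<Union>i\<in>I. X i) x \<le> (\<integral>\<^sup>+i. indicator (X i) x \<partial>count_space I)"
    proof (cases "x \<in> (\<Union>i\<in>I. X i)")
      case True
      then obtain i where i: "i \<in> I" "x \<in> X i" by auto
      have "(1::ennreal) = (\<integral>\<^sup>+j. indicator {i} j \<partial>count_space I)"
        using i by (subst nn_integral_indicator) auto
      also have "\<dots> \<le> (\<integral>\<^sup>+j. indicator (X j) x \<partial>count_space I)"
        using i by (intro nn_integral_mono) (auto simp: indicator_def)
      finally show ?thesis using True by simp
    qed simp
  qed
  also have "\<dots> = (\<integral>\<^sup>+i. \<integral>\<^sup>+x. indicator (X i) x \<partial>M \<partial>count_space I)"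
    by (intro nn_integral_count_space_nn_integral assms) measurable
  also have "\<dots> = (\<integral>\<^sup>+i. emeasure M (X i) \<partial>count_space I)"
    by (intro nn_integral_cong) auto
  finally show ?thesis .
qed

lemma nn_integral_lborel_translation:
  fixes f :: "'a::euclidean_space \<Rightarrow> ennreal"
  assumes [measurable]: "f \<in> borel_measurable borel"
  shows "(\<integral>\<^sup>+y. f (c + y) \<partial>lborel) = (\<integral>\<^sup>+y. f y \<partial>lborel)"
proof -
  have "(\<integral>\<^sup>+y. f y \<partial>lborel) = (\<integral>\<^sup>+y. f y \<partial>distr lborel borel ((+) c))"
    by (simp add: lborel_distr_plus)
  also have "\<dots> = (\<integral>\<^sup>+y. f (c + y) \<partial>lborel)"
    by (subst nn_integral_distr) auto
  finally show ?thesis by simp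
qed

lemma nn_integral_translated_ball:
  fixes g :: "'a::euclidean_space \<Rightarrow> ennreal"
  assumes [measurable]: "g \<in> borel_measurable borel"
  shows "(\<integral>\<^sup>+y. g (x + y) * indicator (ball 0 r) y \<partial>lborel) = emeasure (density lborel g) (ball x r)"
proof -
  have "emeasure (density lborel g) (ball x r) = (\<integral>\<^sup>+y. g y * indicator (ball x r) y \<partial>lborel)"
    by (simp add: emeasure_density)
  also have "\<dots> = (\<integral>\<^sup>+y. g (x + y) * indicator (ball x r) (x + y) \<partial>lborel)"
    by (rule nn_integral_lborel_translation[symmetric]) measurable
  also have "\<dots> = (\<integral>\<^sup>+y. g (x + y) * indicator (ball 0 r) y \<partial>lborel)"
    by (intro nn_integral_cong) (simp add: indicator_def dist_norm)
  finally show ?thesis by simp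
qed

theorem HL_max_weak_type:
  fixes g :: "'a::euclidean_space \<Rightarrow> ennreal"
  assumes [measurable]: "g \<in> borel_measurable borel" and "0 < l"
  shows "emeasure lborel {x. ennreal l < HL_max g x} \<le> ennreal (5 ^ DIM('a) / l) * (\<integral>\<^sup>+x. g x \<partial>lborel)"
proof (cases "(\<integral>\<^sup>+x. g x \<partial>lborel)")
  case top
  then show ?thesis using \<open>0 < l\<close> by (simp add: ennreal_mult_top)
next
  case (real G)
  define n where "n = DIM('a)"
  define S where "S = {x. ennreal l < HL_max g x}"
  \<comment> \<open>As a measure, the integral of \<open>g\<close> over disjoint balls adds up by
    countable additivity and stays below the total mass G.\<close>
  define \<nu> where "\<nu> = density lborel g"
  have [measurable]: "S \<in> sets borel"
    unfolding S_def by measurable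
  have \<nu>_le: "emeasure \<nu> A \<le> ennreal G" for A
    using emeasure_space[of \<nu> A] real by (simp add: \<nu>_def emeasure_density)
  have "\<exists>r>0. ennreal l * emeasure lborel (ball x r) \<le> emeasure \<nu> (ball x r)" if "x \<in> S" for x
  proof -
    obtain r where r: "0 < r" "ennreal l < avg (ball 0 r) g x"
      using \<open>x \<in> S\<close> by (auto simp: S_def HL_max_def less_SUP_iff)
    have "ennreal l * emeasure lborel (ball (0::'a) r) \<le>
        avg (ball 0 r) g x * emeasure lborel (ball (0::'a) r)"
      using r by (intro mult_right_mono) auto
    also have "\<dots> = emeasure \<nu> (ball x r)"
      using emeasure_ball_pos_finite[OF r(1), of "0::'a"]
      by (simp add: avg_def ennreal_divide_times ennreal_divide_self nn_integral_translated_ball \<nu>_def)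
    finally show ?thesis
      using r by (auto simp: emeasure_ball)
  qed
  then obtain r where r0: "\<And>x. x \<in> S \<Longrightarrow> 0 < r x"
    and r: "\<And>x. x \<in> S \<Longrightarrow> ennreal l * emeasure lborel (ball x (r x)) \<le> emeasure \<nu> (ball x (r x))"
    by metis
  \<comment> \<open>The covering lemma asks for bounded radii. Comparing l times the volume of a
    selected ball with G bounds r^n, and r is at most r^n once r exceeds 1; hence the maximum with
    1.\<close>
  define B where "B = max 1 (G / (l * unit_ball_vol n))"
  have vpos: "0 < unit_ball_vol (real n)"
    by simp
  have rB: "r x \<le> B" if "x \<in> S" for x
  proof (cases "r x \<le> 1")
    case False
    have "ennreal (l * (unit_ball_vol n * r x ^ n)) \<le> ennreal G"
      using order_trans[OF r[OF that] \<nu>_le] r0[OF that] \<open>0 < l\<close>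
      by (simp add: emeasure_ball n_def ennreal_mult)
    then have "l * (unit_ball_vol n * r x ^ n) \<le> G"
      using real by simp
    then have "r x ^ n \<le> G / (l * unit_ball_vol n)"
      using \<open>0 < l\<close> vpos by (simp add: field_simps)
    moreover have "r x \<le> r x ^ n"
      using False power_increasing[of 1 n "r x"] by (simp add: n_def Suc_leI)
    ultimately show ?thesis
      by (simp add: B_def)
  qed (simp add: B_def)
  obtain C where C: "countable C" "C \<subseteq> S"
    and disj: "pairwise (\<lambda>i j. disjnt (ball i (r i)) (ball j (r j))) C"
    and cov: "S \<subseteq> (\<Union>i\<in>C. ball i (5 * r i))"
    using r0 rB by (rule_tac Vitali_covering_lemma_balls[where S = S and K = S and a = "\<lambda>x. x" and r = r and B = B]) auto
  have "emeasure lborel S \<le> emeasure lborel (\<Union>i\<in>C. ball i (5 * r i))"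
    using cov C(1) by (intro emeasure_mono) auto
  also have "\<dots> \<le> (\<integral>\<^sup>+i. emeasure lborel (ball i (5 * r i)) \<partial>count_space C)"
    using C(1) by (intro emeasure_UN_le_countable) auto
  also have "\<dots> \<le> (\<integral>\<^sup>+i. ennreal (5 ^ n / l) * emeasure \<nu> (ball i (r i)) \<partial>count_space C)"
  proof (intro nn_integral_mono)
    fix i assume "i \<in> space (count_space C)"
    then have i: "i \<in> S" using C by auto
    \<comment> \<open>The covering lemma enlarges radii by 5, so volumes grow by 5^n; dividing by l
      turns the choice of the balls into an upper bound for their volume.\<close>
    have "emeasure lborel (ball i (5 * r i)) = ennreal (5 ^ n / l) * (ennreal l * emeasure lborel (ball i (r i)))"
      using r0[OF i] \<open>0 < l\<close> vpos
      by (simp add: emeasure_ball n_def ennreal_mult[symmetric] power_mult_distrib)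
    also have "\<dots> \<le> ennreal (5 ^ n / l) * emeasure \<nu> (ball i (r i))"
      by (intro mult_left_mono r i) auto
    finally show "emeasure lborel (ball i (5 * r i)) \<le> ennreal (5 ^ n / l) * emeasure \<nu> (ball i (r i))" .
  qed
  also have "\<dots> = ennreal (5 ^ n / l) * (\<integral>\<^sup>+i. emeasure \<nu> (ball i (r i)) \<partial>count_space C)"
    by (intro nn_integral_cmult) auto
  also have "(\<integral>\<^sup>+i. emeasure \<nu> (ball i (r i)) \<partial>count_space C) = emeasure \<nu> (\<Union>i\<in>C. ball i (r i))"
    using disj C(1) by (intro emeasure_UN_countable[symmetric])
      (auto simp: \<nu>_def disjoint_family_on_def pairwise_def disjnt_def)
  also have "ennreal (5 ^ n / l) * \<dots> \<le> ennreal (5 ^ n / l) * ennreal G"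
    by (intro mult_left_mono \<nu>_le) auto
  finally show ?thesis
    unfolding real S_def n_def .
qed

section \<open>From weak type to strong type\<close>

lemma emeasure_HL_max_gt_le:
  fixes g :: "'a::euclidean_space \<Rightarrow> ennreal"
  assumes [measurable]: "g \<in> borel_measurable borel" and "0 < l"
  shows "emeasure lborel {x. ennreal l < HL_max g x} \<le>
    ennreal (2 * 5 ^ DIM('a) / l) * (\<integral>\<^sup>+x. g x * indicator {x. ennreal l < 2 * g x} x \<partial>lborel)"
proof -
  txt \<open>Discarding the values of \<open>g\<close> up to \<open>l / 2\<close> lowers every average by at most \<open>l / 2\<close>.\<close>
  define h where "h x = g x * indicator {x. ennreal l < 2 * g x} x" for x
  have [measurable]: "h \<in> borel_measurable borel"
    unfolding h_def by measurable
  have l2: "2 * ennreal (l / 2) = ennreal l"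
    using \<open>0 < l\<close> by (simp add: ennreal_mult[symmetric] flip: ennreal_numeral)
  have g_le: "g x \<le> h x + ennreal (l / 2)" for x
  proof (cases "ennreal l < 2 * g x")
    case False
    then have "2 * g x \<le> 2 * ennreal (l / 2)"
      using l2 by simp
    then have "g x \<le> ennreal (l / 2)"
      by (subst (asm) ennreal_mult_le_mult_iff) auto
    then show ?thesis
      by (simp add: add_increasing)
  qed (simp add: h_def)
  have "HL_max g x \<le> HL_max h x + ennreal (l / 2)" for x
    unfolding HL_max_def
  proof (rule SUP_least)
    fix r :: real assume r: "r \<in> {r \<in> \<rat>. 0 < r}"
    let ?B = "ball (0::'a) r"
    have B: "emeasure lborel ?B \<noteq> 0" "emeasure lborel ?B < top"
      using emeasure_ball_pos_finite[of r "0::'a"] r by auto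
    have "(\<integral>\<^sup>+y. g (x + y) * indicator ?B y \<partial>lborel) \<le>
        (\<integral>\<^sup>+y. h (x + y) * indicator ?B y + ennreal (l / 2) * indicator ?B y \<partial>lborel)"
      using g_le by (intro nn_integral_mono) (simp add: indicator_def)
    also have "\<dots> = (\<integral>\<^sup>+y. h (x + y) * indicator ?B y \<partial>lborel) + ennreal (l / 2) * emeasure lborel ?B"
      by (subst nn_integral_add) (auto simp: nn_integral_cmult)
    finally have "avg ?B g x \<le> ((\<integral>\<^sup>+y. h (x + y) * indicator ?B y \<partial>lborel) +
        ennreal (l / 2) * emeasure lborel ?B) / emeasure lborel ?B"
      unfolding avg_def by (rule divide_right_mono_ennreal)
    also have "\<dots> = avg ?B h x + ennreal (l / 2)"
      using B by (simp add: add_divide_distrib_ennreal avg_def mult_divide_eq_ennreal)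
    also have "\<dots> \<le> (SUP r\<in>{r \<in> \<rat>. 0 < r}. avg (ball 0 r) h x) + ennreal (l / 2)"
      using r by (intro add_right_mono SUP_upper) auto
    finally show "avg ?B g x \<le> (SUP r\<in>{r \<in> \<rat>. 0 < r}. avg (ball 0 r) h x) + ennreal (l / 2)" .
  qed
  then have "ennreal (l / 2) < HL_max h x" if "ennreal l < HL_max g x" for x
  proof -
    have "ennreal (l / 2) + ennreal (l / 2) < HL_max h x + ennreal (l / 2)"
      using less_le_trans[OF that \<open>HL_max g x \<le> _\<close>] l2 by (simp add: mult_2)
    then show ?thesis
      by (metis add_right_mono not_le)
  qed
  then have "emeasure lborel {x. ennreal l < HL_max g x} \<le> emeasure lborel {x. ennreal (l / 2) < HL_max h x}"
    by (intro emeasure_mono) auto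
  also have "\<dots> \<le> ennreal (5 ^ DIM('a) / (l / 2)) * (\<integral>\<^sup>+x. h x \<partial>lborel)"
    using \<open>0 < l\<close> by (intro HL_max_weak_type) auto
  finally show ?thesis
    by (simp add: h_def mult.commute)
qed

text \<open>The factor \<open>2 * 5 ^ n\<close> is the weak type constant at level l / 2,
  \<open>p / (p - 1)\<close> compares the layer-cake weights for the exponents p and p - 1, and
  \<open>2 powr (p - 1)\<close> comes from raising \<open>2 * g\<close> to the power p - 1.\<close>

definition HL_const :: "nat \<Rightarrow> real \<Rightarrow> real" where
  "HL_const n p = 2 * 5 ^ n * p / (p - 1) * 2 powr (p - 1)"

text \<open>Inserting the plain weak type bound into the layer-cake formula would leave the
  divergent integral of l^(p - 2) over all positive l. With the truncated bound, l is confined below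
  \<open>2 * g x\<close>, and the formula read backwards with weight \<open>g\<close> produces g *
  (2 * g)^(p - 1), a multiple of g^p.\<close>

theorem HL_max_strong_type:
  fixes g :: "'a::euclidean_space \<Rightarrow> ennreal"
  assumes [measurable]: "g \<in> borel_measurable borel" and "1 < p"
  shows "(\<integral>\<^sup>+x. ennreal_pow (HL_max g x) p \<partial>lborel) \<le>
    ennreal (HL_const DIM('a) p) * (\<integral>\<^sup>+x. ennreal_pow (g x) p \<partial>lborel)"
proof -
  let ?A = "2 * 5 ^ DIM('a) * p / (p - 1)"
  let ?w = "\<lambda>l. (\<integral>\<^sup>+x. g x * indicator {x. ennreal l < 2 * g x} x \<partial>lborel)"
  have "(\<integral>\<^sup>+x. ennreal_pow (HL_max g x) p \<partial>lborel) = (\<integral>\<^sup>+x. 1 * ennreal_pow (HL_max g x) p \<partial>lborel)"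
    by simp
  also have "\<dots> = (\<integral>\<^sup>+l. ennreal (p * l powr (p - 1)) * indicator {0<..} l *
       (\<integral>\<^sup>+x. 1 * indicator {x. ennreal l < HL_max g x} x \<partial>lborel) \<partial>lborel)"
    using \<open>1 < p\<close> by (intro nn_integral_mult_ennreal_pow) auto
  also have "\<dots> \<le> (\<integral>\<^sup>+l. ennreal ?A *
       (ennreal ((p - 1) * l powr (p - 1 - 1)) * indicator {0<..} l * ?w l) \<partial>lborel)"
  proof (rule nn_integral_mono)
    fix l :: real
    show "ennreal (p * l powr (p - 1)) * indicator {0<..} l *
        (\<integral>\<^sup>+x. 1 * indicator {x. ennreal l < HL_max g x} x \<partial>lborel) \<le>
      ennreal ?A * (ennreal ((p - 1) * l powr (p - 1 - 1)) * indicator {0<..} l * ?w l)"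
    proof (cases "0 < l")
      case True
      have "(\<integral>\<^sup>+x. 1 * indicator {x. ennreal l < HL_max g x} x \<partial>lborel) =
          emeasure lborel {x. ennreal l < HL_max g x}"
        by simp
      also have "\<dots> \<le> ennreal (2 * 5 ^ DIM('a) / l) * ?w l"
        using True by (intro emeasure_HL_max_gt_le) auto
      finally have "ennreal (p * l powr (p - 1)) * (\<integral>\<^sup>+x. 1 * indicator {x. ennreal l < HL_max g x} x \<partial>lborel)
          \<le> ennreal (p * l powr (p - 1)) * (ennreal (2 * 5 ^ DIM('a) / l) * ?w l)"
        by (intro mult_left_mono) auto
      also have "\<dots> = ennreal (p * l powr (p - 1) * (2 * 5 ^ DIM('a) / l)) * ?w l"
        using True \<open>1 < p\<close> by (subst ennreal_mult) (auto simp: mult.assoc)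
      also have "p * l powr (p - 1) * (2 * 5 ^ DIM('a) / l) = ?A * ((p - 1) * l powr (p - 1 - 1))"
        using True \<open>1 < p\<close> by (simp add: powr_diff field_simps power2_eq_square)
      also have "ennreal \<dots> * ?w l = ennreal ?A * (ennreal ((p - 1) * l powr (p - 1 - 1)) * ?w l)"
        using \<open>1 < p\<close> by (subst ennreal_mult) (auto simp: mult.assoc)
      finally show ?thesis
        using True by simp
    qed simp
  qed
  also have "\<dots> = ennreal ?A * (\<integral>\<^sup>+l. ennreal ((p - 1) * l powr (p - 1 - 1)) * indicator {0<..} l * ?w l \<partial>lborel)"
    by (intro nn_integral_cmult) measurable
  also have "(\<integral>\<^sup>+l. ennreal ((p - 1) * l powr (p - 1 - 1)) * indicator {0<..} l * ?w l \<partial>lborel) =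
      (\<integral>\<^sup>+x. g x * ennreal_pow (2 * g x) (p - 1) \<partial>lborel)"
    using \<open>1 < p\<close> by (intro nn_integral_mult_ennreal_pow[symmetric]) auto
  also have "\<dots> = (\<integral>\<^sup>+x. ennreal (2 powr (p - 1)) * ennreal_pow (g x) p \<partial>lborel)"
  proof (intro nn_integral_cong)
    fix x
    have "g x * ennreal_pow (2 * g x) (p - 1) = g x * (ennreal (2 powr (p - 1)) * ennreal_pow (g x) (p - 1))"
      using ennreal_pow_cmult[of 2 "p - 1" "g x"] \<open>1 < p\<close> by simp
    then show "g x * ennreal_pow (2 * g x) (p - 1) = ennreal (2 powr (p - 1)) * ennreal_pow (g x) p"
      unfolding mult_ennreal_pow[OF \<open>1 < p\<close>, symmetric] by (simp add: ac_simps)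
  qed
  also have "\<dots> = ennreal (2 powr (p - 1)) * (\<integral>\<^sup>+x. ennreal_pow (g x) p \<partial>lborel)"
    by (intro nn_integral_cmult) measurable
  also have "ennreal ?A * \<dots> = ennreal (HL_const DIM('a) p) * (\<integral>\<^sup>+x. ennreal_pow (g x) p \<partial>lborel)"
    using \<open>1 < p\<close> unfolding HL_const_def by (subst ennreal_mult) (auto simp: mult.assoc)
  finally show ?thesis .
qed

section \<open>The iterated maximal function\<close>

definition strong_max :: "('a::euclidean_space \<times> 'b::euclidean_space \<Rightarrow> ennreal) \<Rightarrow> 'a \<times> 'b \<Rightarrow> ennreal" where
  "strong_max g = (\<lambda>(x1, x2). HL_max (\<lambda>s. HL_max (\<lambda>t. g (s, t)) x2) x1)"

lemma strong_max_Pair: "strong_max g (x1, x2) = HL_max (\<lambda>s. HL_max (\<lambda>t. g (s, t)) x2) x1"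
  by (simp add: strong_max_def)

lemma borel_measurable_inner_HL_max:
  fixes g :: "'a::euclidean_space \<times> 'b::euclidean_space \<Rightarrow> ennreal"
  assumes [measurable]: "g \<in> borel_measurable borel"
  shows "(\<lambda>(s, x2). HL_max (\<lambda>t. g (s, t)) x2) \<in> borel_measurable (borel \<Otimes>\<^sub>M borel)"
  by (rule borel_measurable_HL_max_pair) (simp add: borel_prod)

lemma borel_measurable_strong_max [measurable]:
  fixes g :: "'a::euclidean_space \<times> 'b::euclidean_space \<Rightarrow> ennreal"
  assumes [measurable]: "g \<in> borel_measurable borel"
  shows "strong_max g \<in> borel_measurable borel"
proof -
  note [measurable] = borel_measurable_inner_HL_max[OF assms]
  \<comment> \<open>The coordinates are swapped because the outer maximal function acts in
    \<open>s\<close>, with \<open>x2\<close> as its parameter, and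
    \<open>borel_measurable_HL_max_pair\<close> expects the parameter first.\<close>
  have "(\<lambda>(x2, s). HL_max (\<lambda>t. g (s, t)) x2) \<in> borel_measurable (borel \<Otimes>\<^sub>M borel)"
    by measurable
  from borel_measurable_HL_max_pair[OF this]
  have [measurable]: "(\<lambda>(x2, x1). HL_max (\<lambda>s. HL_max (\<lambda>t. g (s, t)) x2) x1) \<in> borel_measurable (borel \<Otimes>\<^sub>M borel)" .
  show ?thesis
    unfolding strong_max_def borel_prod[symmetric] by measurable
qed

text \<open>The outer operator is bounded in the first variable for each fixed \<open>x2\<close>.
  After Tonelli exchanges the integrals, the inner one is bounded in the second variable for each
  fixed \<open>s\<close>, so the two constants multiply.\<close>

theorem strong_max_strong_type:
  fixes g :: "'a::euclidean_space \<times> 'b::euclidean_space \<Rightarrow> ennreal"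
  assumes [measurable]: "g \<in> borel_measurable borel" and "1 < p"
  shows "(\<integral>\<^sup>+x. ennreal_pow (strong_max g x) p \<partial>lborel) \<le>
    ennreal (HL_const DIM('a) p * HL_const DIM('b) p) * (\<integral>\<^sup>+x. ennreal_pow (g x) p \<partial>lborel)"
proof -
  define h where "h s x2 = HL_max (\<lambda>t. g (s, t)) x2" for s x2
  have h [measurable]: "(\<lambda>(s, x2). h s x2) \<in> borel_measurable (borel \<Otimes>\<^sub>M borel)"
    unfolding h_def by (rule borel_measurable_inner_HL_max) measurable
  have [measurable]: "(\<lambda>x. ennreal_pow (strong_max g x) p) \<in> borel_measurable (lborel \<Otimes>\<^sub>M lborel)"
    "(\<lambda>x. ennreal_pow (g x) p) \<in> borel_measurable (lborel \<Otimes>\<^sub>M lborel)"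
    by (simp_all add: lborel_prod)
  have pos: "0 \<le> HL_const n p" for n
    using \<open>1 < p\<close> by (simp add: HL_const_def)
  have "(\<integral>\<^sup>+x. ennreal_pow (strong_max g x) p \<partial>lborel) =
      (\<integral>\<^sup>+x2. \<integral>\<^sup>+x1. ennreal_pow (HL_max (\<lambda>s. h s x2) x1) p \<partial>lborel \<partial>lborel)"
    unfolding lborel_prod[symmetric]
    by (subst lborel_pair.nn_integral_snd[symmetric]) (simp_all add: strong_max_Pair h_def)
  also have "\<dots> \<le> (\<integral>\<^sup>+x2. ennreal (HL_const DIM('a) p) * (\<integral>\<^sup>+s. ennreal_pow (h s x2) p \<partial>lborel) \<partial>lborel)"
    using \<open>1 < p\<close> by (intro nn_integral_mono HL_max_strong_type) measurable
  also have "\<dots> = ennreal (HL_const DIM('a) p) * (\<integral>\<^sup>+x2. \<integral>\<^sup>+s. ennreal_pow (h s x2) p \<partial>lborel \<partial>lborel)"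
    by (intro nn_integral_cmult) measurable
  also have "(\<integral>\<^sup>+x2. \<integral>\<^sup>+s. ennreal_pow (h s x2) p \<partial>lborel \<partial>lborel) =
      (\<integral>\<^sup>+s. \<integral>\<^sup>+x2. ennreal_pow (h s x2) p \<partial>lborel \<partial>lborel)"
    by (rule lborel_pair.Fubini') measurable
  also have "\<dots> \<le> (\<integral>\<^sup>+s. ennreal (HL_const DIM('b) p) * (\<integral>\<^sup>+t. ennreal_pow (g (s, t)) p \<partial>lborel) \<partial>lborel)"
    using \<open>1 < p\<close> unfolding h_def by (intro nn_integral_mono HL_max_strong_type) measurable
  also have "\<dots> = ennreal (HL_const DIM('b) p) * (\<integral>\<^sup>+s. \<integral>\<^sup>+t. ennreal_pow (g (s, t)) p \<partial>lborel \<partial>lborel)"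
    by (intro nn_integral_cmult) measurable
  also have "(\<integral>\<^sup>+s. \<integral>\<^sup>+t. ennreal_pow (g (s, t)) p \<partial>lborel \<partial>lborel) = (\<integral>\<^sup>+x. ennreal_pow (g x) p \<partial>lborel)"
    unfolding lborel_prod[symmetric] by (rule lborel.nn_integral_fst) measurable
  finally show ?thesis
    using pos by (simp add: ennreal_mult mult.assoc mult_left_mono)
qed

lemma emeasure_lborel_Times:
  assumes "U \<in> sets borel" "V \<in> sets borel"
  shows "emeasure lborel (U \<times> V :: ('a::euclidean_space \<times> 'b::euclidean_space) set) =
    emeasure lborel U * emeasure lborel V"
  unfolding lborel_prod[symmetric] using assms by (simp add: lborel.emeasure_pair_measure_Times)

text \<open>An average over a product is an average of averages: the inner one is dominated for each
  \<open>s\<close>, and the result is averaged over a ball in the first variable. The radii never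
  interact. This domination is why the iterated operator can stand in for the supremum over products
  of balls.\<close>

lemma avg_Times_ball_le_strong_max:
  fixes g :: "'a::euclidean_space \<times> 'b::euclidean_space \<Rightarrow> ennreal"
  assumes [measurable]: "g \<in> borel_measurable borel" and "0 < r" "0 < r'"
  shows "avg (ball 0 r \<times> ball 0 r') g x \<le> strong_max g x"
proof -
  obtain x1 x2 where x: "x = (x1, x2)" by (cases x)
  let ?U = "ball (0::'a) r" and ?V = "ball (0::'b) r'"
  note U = emeasure_ball_pos_finite[OF \<open>0 < r\<close>, of "0::'a"]
  note V = emeasure_ball_pos_finite[OF \<open>0 < r'\<close>, of "0::'b"]
  have g2 [measurable]: "g \<in> borel_measurable (borel \<Otimes>\<^sub>M borel)"
    by (simp add: borel_prod)
  have [measurable]: "?U \<times> ?V \<in> sets borel"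
    by (intro borel_open open_Times open_ball)
  have "(\<integral>\<^sup>+y. g (x + y) * indicator (?U \<times> ?V) y \<partial>lborel) =
      (\<integral>\<^sup>+s. \<integral>\<^sup>+t. g (x + (s, t)) * indicator (?U \<times> ?V) (s, t) \<partial>lborel \<partial>lborel)"
    unfolding lborel_prod[symmetric] by (rule lborel.nn_integral_fst[symmetric]) (simp add: lborel_prod, measurable)
  also have "\<dots> = (\<integral>\<^sup>+s. \<integral>\<^sup>+t. (g (x1 + s, x2 + t) * indicator ?V t) * indicator ?U s \<partial>lborel \<partial>lborel)"
    by (simp add: x indicator_times ac_simps)
  also have "\<dots> = (\<integral>\<^sup>+s. (\<integral>\<^sup>+t. g (x1 + s, x2 + t) * indicator ?V t \<partial>lborel) * indicator ?U s \<partial>lborel)"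
    by (intro nn_integral_cong nn_integral_multc) measurable
  finally have eq: "(\<integral>\<^sup>+y. g (x + y) * indicator (?U \<times> ?V) y \<partial>lborel) = \<dots>" .
  have "avg (?U \<times> ?V) g x =
     (\<integral>\<^sup>+s. (\<integral>\<^sup>+t. g (x1 + s, x2 + t) * indicator ?V t \<partial>lborel) * indicator ?U s \<partial>lborel)
       * (inverse (emeasure lborel ?V) * inverse (emeasure lborel ?U))"
    using U V unfolding avg_def eq
    by (simp add: emeasure_lborel_Times divide_ennreal_def ennreal_inverse_mult mult.commute)
  also have "\<dots> = (\<integral>\<^sup>+s. avg ?V (\<lambda>t. g (x1 + s, t)) x2 * indicator ?U s \<partial>lborel) / emeasure lborel ?U"
    unfolding avg_def divide_ennreal_def
    by (subst mult.assoc[symmetric], subst nn_integral_multc[symmetric]) (auto simp: ac_simps)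
  also have "\<dots> \<le> (\<integral>\<^sup>+s. HL_max (\<lambda>t. g (x1 + s, t)) x2 * indicator ?U s \<partial>lborel) / emeasure lborel ?U"
    using \<open>0 < r'\<close>
    by (intro divide_right_mono_ennreal nn_integral_mono mult_right_mono avg_ball_le_HL_max) auto
  also have "\<dots> = avg ?U (\<lambda>s. HL_max (\<lambda>t. g (s, t)) x2) x1"
    by (simp add: avg_def)
  also have "\<dots> \<le> strong_max g x"
  proof -
    note [measurable] = borel_measurable_inner_HL_max[OF assms(1)]
    show ?thesis
      using \<open>0 < r\<close> unfolding strong_max_def x by (simp, intro avg_ball_le_HL_max) measurable
  qed
  finally show ?thesis .
qed

section \<open>Measurability of uncountable suprema of averages\<close>

lemma closed_avg_le:
  fixes g :: "'a::euclidean_space \<Rightarrow> ennreal"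
  assumes [measurable]: "g \<in> borel_measurable borel"
    and "open U" and U: "emeasure lborel U \<noteq> 0" "emeasure lborel U < top"
  shows "closed {x. avg U g x \<le> c}"
proof -
  have [measurable]: "U \<in> sets borel"
    using \<open>open U\<close> by simp
  \<comment> \<open>The translation moves from \<open>g\<close>, which is merely measurable, to the
    indicator of an open set, which is lower semicontinuous. Fatou can then be applied along a
    convergent sequence of centres.\<close>
  have shift: "(\<integral>\<^sup>+y. g (x + y) * indicator U y \<partial>lborel) = (\<integral>\<^sup>+y. g y * indicator U (y - x) \<partial>lborel)" for x
    by (subst nn_integral_lborel_translation[of "\<lambda>y. g y * indicator U (y - x)" x, symmetric]) auto
  have avg_le_iff: "avg U g x \<le> c \<longleftrightarrow> (\<integral>\<^sup>+y. g y * indicator U (y - x) \<partial>lborel) \<le> c * emeasure lborel U" for x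
    unfolding avg_def shift
  proof
    let ?F = "\<integral>\<^sup>+y. g y * indicator U (y - x) \<partial>lborel" and ?k = "emeasure lborel U"
    assume "?F / ?k \<le> c"
    then have "?F / ?k * ?k \<le> c * ?k"
      by (rule mult_right_mono) simp
    then show "?F \<le> c * ?k"
      using U by (simp add: ennreal_divide_times ennreal_divide_self)
  next
    assume "(\<integral>\<^sup>+y. g y * indicator U (y - x) \<partial>lborel) \<le> c * emeasure lborel U"
    then show "(\<integral>\<^sup>+y. g y * indicator U (y - x) \<partial>lborel) / emeasure lborel U \<le> c"
      using U by (intro divide_le_posI_ennreal) (auto simp: mult.commute zero_less_iff_neq_zero)
  qed
  show ?thesis
    unfolding closed_sequential_limits
  proof (intro allI impI, elim conjE)
    fix X x
    assume X: "\<forall>n. X n \<in> {x. avg U g x \<le> c}" and lim: "X \<longlonglongrightarrow> x"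
    have "g y * indicator U (y - x) \<le> liminf (\<lambda>n. g y * indicator U (y - X n))" for y
    proof (cases "y - x \<in> U")
      case True
      have "(\<lambda>n. y - X n) \<longlonglongrightarrow> y - x"
        by (intro tendsto_intros lim)
      from topological_tendstoD[OF this \<open>open U\<close> True] show ?thesis
        using True by (intro Liminf_bounded) (auto elim!: eventually_mono)
    qed auto
    then have "(\<integral>\<^sup>+y. g y * indicator U (y - x) \<partial>lborel) \<le>
        (\<integral>\<^sup>+y. liminf (\<lambda>n. g y * indicator U (y - X n)) \<partial>lborel)"
      by (intro nn_integral_mono)
    also have "\<dots> \<le> liminf (\<lambda>n. \<integral>\<^sup>+y. g y * indicator U (y - X n) \<partial>lborel)"
      by (intro nn_integral_liminf) measurable
    also have "\<dots> \<le> c * emeasure lborel U"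
      using X by (intro Liminf_le always_eventually) (auto simp: avg_le_iff)
    finally show "x \<in> {x. avg U g x \<le> c}"
      by (simp add: avg_le_iff)
  qed
qed

text \<open>A sublevel set of the supremum is an intersection of closed sets, hence closed however
  large the index set is.\<close>

lemma borel_measurable_SUP_avg:
  fixes g :: "'a::euclidean_space \<Rightarrow> ennreal"
  assumes g: "g \<in> borel_measurable borel"
    and U: "\<And>i. i \<in> I \<Longrightarrow> open (U i)" "\<And>i. i \<in> I \<Longrightarrow> emeasure lborel (U i) \<noteq> 0"
      "\<And>i. i \<in> I \<Longrightarrow> emeasure lborel (U i) < top"
  shows "(\<lambda>x. SUP i\<in>I. avg (U i) g x) \<in> borel_measurable borel"
proof (rule borel_measurableI_le)
  fix c
  have "{x. (SUP i\<in>I. avg (U i) g x) \<le> c} = (\<Inter>i\<in>I. {x. avg (U i) g x \<le> c})"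
    by (auto simp: SUP_le_iff)
  also have "closed \<dots>"
    using assms by (intro closed_INT ballI closed_avg_le)
  finally show "{x \<in> space borel. (SUP i\<in>I. avg (U i) g x) \<le> c} \<in> sets borel"
    by simp
qed

section \<open>Measure-preserving linear changes of variable\<close>

definition measure_preserving_iso :: "('a::euclidean_space \<Rightarrow> 'a) \<Rightarrow> ('a \<Rightarrow> 'a) \<Rightarrow> bool" where
  "measure_preserving_iso \<phi> \<psi> \<longleftrightarrow>
     continuous_on UNIV \<phi> \<and> continuous_on UNIV \<psi> \<and>
     (\<forall>x y. \<phi> (x + y) = \<phi> x + \<phi> y) \<and> (\<forall>x. \<phi> (\<psi> x) = x) \<and> (\<forall>x. \<psi> (\<phi> x) = x) \<and>
     (\<forall>G\<in>borel_measurable borel. (\<integral>\<^sup>+x. G (\<phi> x) \<partial>lborel) = (\<integral>\<^sup>+x. (G x::ennreal) \<partial>lborel))"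

context
  fixes \<phi> \<psi> :: "'a::euclidean_space \<Rightarrow> 'a"
  assumes iso: "measure_preserving_iso \<phi> \<psi>"
begin

lemma iso_measurable: "\<phi> \<in> borel_measurable borel" "\<psi> \<in> borel_measurable borel"
  using iso by (auto simp: measure_preserving_iso_def intro!: borel_measurable_continuous_onI)

lemma iso_add: "\<phi> (x + y) = \<phi> x + \<phi> y"
  and iso_inverse [simp]: "\<phi> (\<psi> x) = x" "\<psi> (\<phi> x) = x"
  using iso by (auto simp: measure_preserving_iso_def)

lemma nn_integral_iso:
  fixes G :: "'a \<Rightarrow> ennreal"
  shows "G \<in> borel_measurable borel \<Longrightarrow> (\<integral>\<^sup>+x. G (\<phi> x) \<partial>lborel) = (\<integral>\<^sup>+x. G x \<partial>lborel)"
  using iso by (auto simp: measure_preserving_iso_def)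

lemma nn_integral_iso_inverse:
  fixes G :: "'a \<Rightarrow> ennreal"
  assumes [measurable]: "G \<in> borel_measurable borel"
  shows "(\<integral>\<^sup>+x. G (\<psi> x) \<partial>lborel) = (\<integral>\<^sup>+x. G x \<partial>lborel)"
proof -
  note [measurable] = iso_measurable
  show ?thesis
    by (subst nn_integral_iso[symmetric]) auto
qed

text \<open>This is where the explicit inverse pays off: images of open sets become preimages under
  a continuous map, hence open and Borel.\<close>

lemma iso_image_eq_vimage: "\<phi> ` U = \<psi> -` U"
proof (intro set_eqI iffI)
  fix x
  assume "x \<in> \<psi> -` U"
  then show "x \<in> \<phi> ` U"
    by (intro image_eqI[of _ _ "\<psi> x"]) auto
qed auto

lemma open_iso_image:
  assumes "open U"
  shows "open (\<phi> ` U)"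
  using iso assms unfolding iso_image_eq_vimage
  by (intro open_vimage) (auto simp: measure_preserving_iso_def)

lemma emeasure_iso_image:
  assumes "open U"
  shows "emeasure lborel (\<phi> ` U) = emeasure lborel U"
proof -
  note [measurable] = iso_measurable borel_open[OF assms] borel_open[OF open_iso_image[OF assms]]
  have "emeasure lborel (\<phi> ` U) = (\<integral>\<^sup>+x. indicator (\<phi> ` U) (\<phi> x) \<partial>lborel)"
    by (subst nn_integral_iso) auto
  also have "\<dots> = (\<integral>\<^sup>+x. indicator U x \<partial>lborel)"
    by (simp add: iso_image_eq_vimage indicator_def)
  finally show ?thesis
    by simp
qed

text \<open>Additivity turns the translate \<open>x + \<phi> y\<close> into
  \<open>\<phi> (\<psi> x + y)\<close>, so an average over the deformed set is an average over the
  original one, with centre and function both transported.\<close>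

lemma avg_iso_image:
  assumes [measurable]: "g \<in> borel_measurable borel" and "open U"
  shows "avg (\<phi> ` U) g x = avg U (g \<circ> \<phi>) (\<psi> x)"
proof -
  note [measurable] = iso_measurable borel_open[OF \<open>open U\<close>] borel_open[OF open_iso_image[OF \<open>open U\<close>]]
  have "(\<integral>\<^sup>+y. g (x + y) * indicator (\<phi> ` U) y \<partial>lborel) =
      (\<integral>\<^sup>+y. g (x + \<phi> y) * indicator (\<phi> ` U) (\<phi> y) \<partial>lborel)"
    by (rule nn_integral_iso[symmetric]) measurable
  also have "\<dots> = (\<integral>\<^sup>+y. g (\<phi> (\<psi> x + y)) * indicator U y \<partial>lborel)"
    by (simp add: iso_image_eq_vimage indicator_def iso_add)
  finally show ?thesis
    by (simp add: avg_def emeasure_iso_image[OF \<open>open U\<close>])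
qed

end

theorem strong_max_iso_strong_type:
  fixes g :: "'a::euclidean_space \<times> 'b::euclidean_space \<Rightarrow> ennreal"
  assumes [measurable]: "g \<in> borel_measurable borel" and "1 < p" and iso: "measure_preserving_iso \<phi> \<psi>"
  shows "(\<integral>\<^sup>+x. ennreal_pow (strong_max (g \<circ> \<phi>) (\<psi> x)) p \<partial>lborel) \<le>
    ennreal (HL_const DIM('a) p * HL_const DIM('b) p) * (\<integral>\<^sup>+x. ennreal_pow (g x) p \<partial>lborel)"
proof -
  note [measurable] = iso_measurable[OF iso]
  have [measurable]: "g \<circ> \<phi> \<in> borel_measurable borel"
    by measurable
  have "(\<integral>\<^sup>+x. ennreal_pow (strong_max (g \<circ> \<phi>) (\<psi> x)) p \<partial>lborel) =
      (\<integral>\<^sup>+x. ennreal_pow (strong_max (g \<circ> \<phi>) x) p \<partial>lborel)"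
    by (rule nn_integral_iso_inverse[OF iso]) measurable
  also have "\<dots> \<le> ennreal (HL_const DIM('a) p * HL_const DIM('b) p) *
      (\<integral>\<^sup>+x. ennreal_pow ((g \<circ> \<phi>) x) p \<partial>lborel)"
    using \<open>1 < p\<close> by (intro strong_max_strong_type) auto
  also have "(\<integral>\<^sup>+x. ennreal_pow ((g \<circ> \<phi>) x) p \<partial>lborel) = (\<integral>\<^sup>+x. ennreal_pow (g x) p \<partial>lborel)"
    unfolding comp_def by (rule nn_integral_iso[OF iso]) measurable
  finally show ?thesis .
qed

section \<open>Shears and the shape of tubes\<close>

definition shear1 :: "'a::euclidean_space \<times> 'a \<Rightarrow> 'a \<times> 'a" where
  "shear1 = (\<lambda>(u, v). (v + u, v))"

definition unshear1 :: "'a::euclidean_space \<times> 'a \<Rightarrow> 'a \<times> 'a" where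
  "unshear1 = (\<lambda>(x1, x2). (x1 - x2, x2))"

definition shear2 :: "'a::euclidean_space \<times> 'a \<Rightarrow> 'a \<times> 'a" where
  "shear2 = (\<lambda>(u, v). (u, u + v))"

definition unshear2 :: "'a::euclidean_space \<times> 'a \<Rightarrow> 'a \<times> 'a" where
  "unshear2 = (\<lambda>(x1, x2). (x1, x2 - x1))"

definition shears :: "(('a::euclidean_space \<times> 'a \<Rightarrow> 'a \<times> 'a) \<times> ('a \<times> 'a \<Rightarrow> 'a \<times> 'a)) set" where
  "shears = {(id, id), (shear1, unshear1), (shear2, unshear2)}"

lemma measure_preserving_iso_id: "measure_preserving_iso id id"
  by (auto simp: measure_preserving_iso_def)

text \<open>For fixed \<open>v\<close> the shear translates the first coordinate by
  \<open>v\<close>, so Tonelli with the integral over \<open>u\<close> inside reduces the claim to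
  translation invariance.\<close>

lemma measure_preserving_iso_shear1:
  "measure_preserving_iso shear1 (unshear1 :: 'a::euclidean_space \<times> 'a \<Rightarrow> _)"
proof -
  have "(\<integral>\<^sup>+x. G (shear1 x) \<partial>lborel) = (\<integral>\<^sup>+x. G x \<partial>lborel)"
    if [measurable]: "G \<in> borel_measurable borel" for G :: "'a \<times> 'a \<Rightarrow> ennreal"
  proof -
    have G [measurable]: "G \<in> borel_measurable (borel \<Otimes>\<^sub>M borel)"
      by (simp add: borel_prod)
    have "(\<integral>\<^sup>+x. G (shear1 x) \<partial>(lborel \<Otimes>\<^sub>M lborel)) = (\<integral>\<^sup>+v. \<integral>\<^sup>+u. G (v + u, v) \<partial>lborel \<partial>lborel)"
      unfolding shear1_def by (subst lborel_pair.nn_integral_snd[symmetric]) auto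
    also have "\<dots> = (\<integral>\<^sup>+v. \<integral>\<^sup>+u. G (u, v) \<partial>lborel \<partial>lborel)"
      by (intro nn_integral_cong nn_integral_lborel_translation) measurable
    also have "\<dots> = (\<integral>\<^sup>+x. G x \<partial>(lborel \<Otimes>\<^sub>M lborel))"
      by (rule lborel_pair.nn_integral_snd) measurable
    finally show ?thesis
      by (simp add: lborel_prod)
  qed
  moreover have "continuous_on UNIV (shear1 :: 'a \<times> 'a \<Rightarrow> _)"
    unfolding shear1_def split_beta by (intro continuous_intros)
  ultimately show ?thesis
    unfolding measure_preserving_iso_def unshear1_def split_beta
    by (intro conjI allI ballI continuous_intros) (simp_all add: shear1_def split_beta)
qed

text \<open>Now \<open>u\<close> is fixed and the second coordinate is translated, so the integral
  over \<open>v\<close> goes inside.\<close>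

lemma measure_preserving_iso_shear2:
  "measure_preserving_iso shear2 (unshear2 :: 'a::euclidean_space \<times> 'a \<Rightarrow> _)"
proof -
  have "(\<integral>\<^sup>+x. G (shear2 x) \<partial>lborel) = (\<integral>\<^sup>+x. G x \<partial>lborel)"
    if [measurable]: "G \<in> borel_measurable borel" for G :: "'a \<times> 'a \<Rightarrow> ennreal"
  proof -
    have G [measurable]: "G \<in> borel_measurable (borel \<Otimes>\<^sub>M borel)"
      by (simp add: borel_prod)
    have "(\<integral>\<^sup>+x. G (shear2 x) \<partial>(lborel \<Otimes>\<^sub>M lborel)) = (\<integral>\<^sup>+u. \<integral>\<^sup>+v. G (u, u + v) \<partial>lborel \<partial>lborel)"
      unfolding shear2_def by (subst lborel.nn_integral_fst[symmetric]) auto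
    also have "\<dots> = (\<integral>\<^sup>+u. \<integral>\<^sup>+v. G (u, v) \<partial>lborel \<partial>lborel)"
      by (intro nn_integral_cong nn_integral_lborel_translation) measurable
    also have "\<dots> = (\<integral>\<^sup>+x. G x \<partial>(lborel \<Otimes>\<^sub>M lborel))"
      by (rule lborel.nn_integral_fst) measurable
    finally show ?thesis
      by (simp add: lborel_prod)
  qed
  moreover have "continuous_on UNIV (shear2 :: 'a \<times> 'a \<Rightarrow> _)"
    unfolding shear2_def split_beta by (intro continuous_intros)
  ultimately show ?thesis
    unfolding measure_preserving_iso_def unshear2_def split_beta
    by (intro conjI allI ballI continuous_intros) (simp_all add: shear2_def split_beta)
qed

lemma measure_preserving_iso_shears:
  "(\<phi>, \<psi>) \<in> shears \<Longrightarrow> measure_preserving_iso \<phi> \<psi>"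
  using measure_preserving_iso_id measure_preserving_iso_shear1 measure_preserving_iso_shear2
  unfolding shears_def by blast

text \<open>The unsheared coordinates are the two linear forms whose norms the case at hand bounds.
  In the third case they are x1 and x2 - x1, in this order, so the radius r3 comes before
  r2.\<close>

lemma tube0_shearE:
  assumes "r \<in> pos_triples"
  obtains \<phi> \<psi> :: "(real ^ 'm) \<times> (real ^ 'm) \<Rightarrow> (real ^ 'm) \<times> (real ^ 'm)" and a b
  where "(\<phi>, \<psi>) \<in> shears" "0 < a" "0 < b" "tube0 r = \<phi> ` (ball 0 a \<times> ball 0 b)"
proof -
  obtain r1 r2 r3 where r: "r = (r1, r2, r3)" by (metis surj_pair)
  then have pos: "0 < r1" "0 < r2" "0 < r3"
    using assms by (auto simp: pos_triples_def)
  consider "r1 \<ge> r3 \<and> r2 \<ge> r3" | "\<not> (r1 \<ge> r3 \<and> r2 \<ge> r3)" "r1 \<ge> r2 \<and> r3 \<ge> r2"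
    | "\<not> (r1 \<ge> r3 \<and> r2 \<ge> r3)" "\<not> (r1 \<ge> r2 \<and> r3 \<ge> r2)" by blast
  then show thesis
  proof cases
    case 1
    then have "tube0 r = {(x1 :: real ^ 'm, x2 :: real ^ 'm). norm x1 < r1 \<and> norm x2 < r2}"
      unfolding r tube0.simps by (rule if_P)
    also have "\<dots> = id ` (ball 0 r1 \<times> ball 0 r2)"
      unfolding iso_image_eq_vimage[OF measure_preserving_iso_id] by auto
    finally show thesis
      by (intro that[of id id]) (auto simp: shears_def pos)
  next
    case 2
    then have "tube0 r = {(x1 :: real ^ 'm, x2 :: real ^ 'm). norm (x1 - x2) < r1 \<and> norm x2 < r3}"
      unfolding r tube0.simps by (simp only: if_False if_True simp_thms)
    also have "\<dots> = shear1 ` (ball 0 r1 \<times> ball 0 r3)"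
      unfolding iso_image_eq_vimage[OF measure_preserving_iso_shear1] by (auto simp: unshear1_def)
    finally show thesis
      by (intro that[of shear1 unshear1]) (auto simp: shears_def pos)
  next
    case 3
    then have "tube0 r = {(x1 :: real ^ 'm, x2 :: real ^ 'm). norm (x2 - x1) < r2 \<and> norm x1 < r3}"
      unfolding r tube0.simps by (simp only: if_False)
    also have "\<dots> = shear2 ` (ball 0 r3 \<times> ball 0 r2)"
      unfolding iso_image_eq_vimage[OF measure_preserving_iso_shear2] by (auto simp: unshear2_def)
    finally show thesis
      by (intro that[of shear2 unshear2]) (auto simp: shears_def pos)
  qed
qed

lemma
  assumes "r \<in> pos_triples"
  shows open_tube0: "open (tube0 r :: ((real ^ 'm) \<times> (real ^ 'm)) set)" (is ?open)
    and emeasure_tube0_nonzero: "emeasure lborel (tube0 r :: ((real ^ 'm) \<times> (real ^ 'm)) set) \<noteq> 0" (is ?nonzero)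
    and emeasure_tube0_finite: "emeasure lborel (tube0 r :: ((real ^ 'm) \<times> (real ^ 'm)) set) < top" (is ?finite)
proof -
  obtain \<phi> \<psi> :: "(real ^ 'm) \<times> (real ^ 'm) \<Rightarrow> _" and a b where
    shear: "(\<phi>, \<psi>) \<in> shears" and ab: "0 < a" "0 < b" and eq: "tube0 r = \<phi> ` (ball 0 a \<times> ball 0 b)"
    using tube0_shearE[OF assms] .
  note iso = measure_preserving_iso_shears[OF shear]
  have o: "open (ball (0 :: real ^ 'm) a \<times> ball (0 :: real ^ 'm) b)"
    by (intro open_Times open_ball)
  note B = emeasure_ball_pos_finite[OF ab(1), of "0 :: real ^ 'm"]
    emeasure_ball_pos_finite[OF ab(2), of "0 :: real ^ 'm"]
  show ?open
    unfolding eq by (rule open_iso_image[OF iso o])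
  have "emeasure lborel (tube0 r :: ((real ^ 'm) \<times> (real ^ 'm)) set) =
      emeasure lborel (ball (0 :: real ^ 'm) a) * emeasure lborel (ball (0 :: real ^ 'm) b)"
    unfolding eq emeasure_iso_image[OF iso o] by (rule emeasure_lborel_Times) simp_all
  then show ?nonzero ?finite
    using B by (simp_all add: ennreal_mult_less_top)
qed

section \<open>The tube maximal function\<close>

lemma M_tube_eq_SUP_avg:
  fixes g :: "(real ^ 'm) \<times> (real ^ 'm) \<Rightarrow> ennreal"
  assumes [measurable]: "g \<in> borel_measurable borel"
    and eq: "AE x in lborel. ennreal (norm (f x)) = g x"
  shows "M_tube f x = (SUP r\<in>pos_triples. avg (tube0 r) g x)"
proof -
  have tube: "(\<integral>\<^sup>+y\<in>tube x r. h y \<partial>lborel) = (\<integral>\<^sup>+y. h (x + y) * indicator (tube0 r) y \<partial>lborel)"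
    and tube_meas: "tube x r \<in> sets borel"
    if "r \<in> pos_triples" and [measurable]: "h \<in> borel_measurable borel"
    for r and h :: "(real ^ 'm) \<times> (real ^ 'm) \<Rightarrow> ennreal"
  proof -
    have [measurable]: "tube x r \<in> sets borel"
      unfolding tube_def by (intro borel_open open_translation open_tube0 \<open>r \<in> pos_triples\<close>)
    then show "tube x r \<in> sets borel" .
    have "(\<integral>\<^sup>+y\<in>tube x r. h y \<partial>lborel) = (\<integral>\<^sup>+y. h (x + y) * indicator (tube x r) (x + y) \<partial>lborel)"
      by (rule nn_integral_lborel_translation[symmetric]) measurable
    then show "(\<integral>\<^sup>+y\<in>tube x r. h y \<partial>lborel) = (\<integral>\<^sup>+y. h (x + y) * indicator (tube0 r) y \<partial>lborel)"
      by (simp add: tube_def indicator_def image_iff)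
  qed
  show ?thesis
    unfolding M_tube_def
  proof (intro SUP_cong refl)
    fix r :: "real \<times> real \<times> real" assume r: "r \<in> pos_triples"
    have "(\<integral>\<^sup>+y\<in>tube x r. ennreal (norm (f y)) \<partial>lebesgue) = (\<integral>\<^sup>+y\<in>tube x r. g y \<partial>lborel)"
      unfolding nn_integral_completion using eq by (intro nn_integral_cong_AE) auto
    \<comment> \<open>The translation identity for the constant function 1 compares the
      volumes.\<close>
    moreover have "emeasure lebesgue (tube x r) = emeasure lborel (tube0 r :: ((real ^ 'm) \<times> (real ^ 'm)) set)"
      using tube[OF r, of "\<lambda>_. 1"] tube_meas[OF r, of "\<lambda>_. 1"] open_tube0[OF r, where 'm = 'm]
      by simp
    ultimately show "(\<integral>\<^sup>+y\<in>tube x r. ennreal (norm (f y)) \<partial>lebesgue) / emeasure lebesgue (tube x r) =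
        avg (tube0 r) g x"
      by (simp add: avg_def tube[OF r])
  qed
qed

text \<open>Each triple of radii selects its own shear, but there are finitely many shears, so the
  largest of their bounds at \<open>x\<close> is attained by one pair and serves all triples at
  once.\<close>

lemma SUP_avg_tube0_le:
  fixes g :: "(real ^ 'm) \<times> (real ^ 'm) \<Rightarrow> ennreal"
  assumes [measurable]: "g \<in> borel_measurable borel"
  shows "\<exists>(\<phi>, \<psi>)\<in>shears. (SUP r\<in>pos_triples. avg (tube0 r) g x) \<le> strong_max (g \<circ> \<phi>) (\<psi> x)"
proof -
  let ?S = "(\<lambda>(\<phi>, \<psi>). strong_max (g \<circ> \<phi>) (\<psi> x)) ` shears"
  have fin: "finite ?S" "?S \<noteq> {}"
    by (auto simp: shears_def)
  have "(SUP r\<in>pos_triples. avg (tube0 r) g x) \<le> Max ?S"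
  proof (rule SUP_least)
    fix r :: "real \<times> real \<times> real" assume "r \<in> pos_triples"
    then obtain \<phi> \<psi> :: "(real ^ 'm) \<times> (real ^ 'm) \<Rightarrow> _" and a b where
      shear: "(\<phi>, \<psi>) \<in> shears" and ab: "0 < a" "0 < b" and eq: "tube0 r = \<phi> ` (ball 0 a \<times> ball 0 b)"
      using tube0_shearE by metis
    note iso = measure_preserving_iso_shears[OF shear]
    note [measurable] = iso_measurable[OF iso]
    have "avg (tube0 r) g x = avg (ball 0 a \<times> ball 0 b) (g \<circ> \<phi>) (\<psi> x)"
      unfolding eq by (intro avg_iso_image[OF iso] open_Times open_ball) measurable
    also have "\<dots> \<le> strong_max (g \<circ> \<phi>) (\<psi> x)"
      using ab by (intro avg_Times_ball_le_strong_max) measurable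
    also have "\<dots> \<le> Max ?S"
      using shear fin by (intro Max_ge) force+
    finally show "avg (tube0 r) g x \<le> Max ?S" .
  qed
  with Max_in[OF fin] show ?thesis
    by force
qed

theorem theorem1p1:
  fixes p :: real
  assumes "1 < p"
  shows "\<exists>C::real. C \<ge> 0 \<and>
    (\<forall>f :: (real ^ 'm) \<times> (real ^ 'm) \<Rightarrow> complex. f \<in> Lp_space p \<longrightarrow>
       M_tube f \<in> borel_measurable lebesgue \<and>
       Lp_norm p (M_tube f) \<le> ennreal C * Lp_norm p (\<lambda>x. ennreal (norm (f x))))"
proof -
  define A where "A = HL_const DIM(real ^ 'm) p * HL_const DIM(real ^ 'm) p"
  \<comment> \<open>Keeping the cardinality symbolic avoids proving that the three pairs are
    distinct.\<close>
  define K where "K = real (card (shears :: (((real ^ 'm) \<times> (real ^ 'm) \<Rightarrow> _) \<times> _) set))"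
  have "0 \<le> A" "0 \<le> K"
    by (simp_all add: A_def K_def)
  show ?thesis
  proof (intro exI[of _ "(K * A) powr (1 / p)"] conjI allI impI)
    fix f :: "(real ^ 'm) \<times> (real ^ 'm) \<Rightarrow> complex"
    assume "f \<in> Lp_space p"
    then have [measurable]: "f \<in> borel_measurable lebesgue"
      by (simp add: Lp_space_def)
    have "(\<lambda>x. ennreal (norm (f x))) \<in> borel_measurable lebesgue"
      by measurable
    from completion_ex_borel_measurable[OF this] obtain g
      where g [measurable]: "g \<in> borel_measurable borel" and eq: "AE x in lborel. ennreal (norm (f x)) = g x"
      by auto
    note M_eq = M_tube_eq_SUP_avg[OF g eq]
    \<comment> \<open>\<open>M_eq\<close> holds at every point, not just almost everywhere, so
      \<open>M_tube f\<close> is even Borel.\<close>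
    have M_meas [measurable]: "M_tube f \<in> borel_measurable borel"
      unfolding M_eq[abs_def] by (intro borel_measurable_SUP_avg open_tube0 emeasure_tube0_nonzero emeasure_tube0_finite g)
    show "M_tube f \<in> borel_measurable lebesgue"
      using M_meas by (intro measurable_completion) simp
    define S :: "((real ^ 'm) \<times> (real ^ 'm) \<Rightarrow> (real ^ 'm) \<times> (real ^ 'm)) \<times>
        ((real ^ 'm) \<times> (real ^ 'm) \<Rightarrow> (real ^ 'm) \<times> (real ^ 'm)) \<Rightarrow> (real ^ 'm) \<times> (real ^ 'm) \<Rightarrow> ennreal"
      where "S = (\<lambda>(\<phi>, \<psi>) x. ennreal_pow (strong_max (g \<circ> \<phi>) (\<psi> x)) p)"
    let ?N = "\<integral>\<^sup>+x. ennreal_pow (g x) p \<partial>lborel"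
    have S_meas: "S s \<in> borel_measurable lborel"
      and S_le: "(\<integral>\<^sup>+x. S s x \<partial>lborel) \<le> ennreal A * ?N" if "s \<in> shears" for s
    proof -
      obtain \<phi> \<psi> where s: "s = (\<phi>, \<psi>)" by (cases s)
      have iso: "measure_preserving_iso \<phi> \<psi>"
        using that s measure_preserving_iso_shears by blast
      note [measurable] = iso_measurable[OF iso]
      show "S s \<in> borel_measurable lborel"
        unfolding S_def s prod.case measurable_lborel1
        by (intro borel_measurable_ennreal_pow
            measurable_compose[OF iso_measurable(2)[OF iso]] borel_measurable_strong_max) measurable
      show "(\<integral>\<^sup>+x. S s x \<partial>lborel) \<le> ennreal A * ?N"
        unfolding S_def s prod.case A_def by (rule strong_max_iso_strong_type[OF g \<open>1 < p\<close> iso])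
    qed
    have fin: "finite (shears :: (((real ^ 'm) \<times> (real ^ 'm) \<Rightarrow> _) \<times> _) set)"
      by (simp add: shears_def)
    \<comment> \<open>The dominating pair varies with \<open>x\<close>; the sum over all pairs
      bounds its term at every point and can be integrated term by term.\<close>
    have "ennreal_pow (M_tube f x) p \<le> (\<Sum>s\<in>shears. S s x)" for x
    proof -
      obtain \<phi> \<psi> where s: "(\<phi>, \<psi>) \<in> shears" and le: "M_tube f x \<le> strong_max (g \<circ> \<phi>) (\<psi> x)"
        using SUP_avg_tube0_le[OF g, of x] unfolding M_eq by blast
      have "ennreal_pow (M_tube f x) p \<le> S (\<phi>, \<psi>) x"
        using le \<open>1 < p\<close> unfolding S_def prod.case by (intro ennreal_pow_mono) auto
      also have "\<dots> \<le> (\<Sum>s\<in>shears. S s x)"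
        by (rule member_le_sum[OF s _ fin]) simp
      finally show ?thesis .
    qed
    then have "(\<integral>\<^sup>+x. ennreal_pow (M_tube f x) p \<partial>lborel) \<le> (\<integral>\<^sup>+x. (\<Sum>s\<in>shears. S s x) \<partial>lborel)"
      by (intro nn_integral_mono)
    also have "\<dots> = (\<Sum>s\<in>shears. \<integral>\<^sup>+x. S s x \<partial>lborel)"
      by (intro nn_integral_sum S_meas)
    also have "\<dots> \<le> (\<Sum>s\<in>(shears :: (((real ^ 'm) \<times> (real ^ 'm) \<Rightarrow> _) \<times> _) set). ennreal A * ?N)"
      by (intro sum_mono S_le)
    also have "\<dots> = ennreal (K * A) * ?N"
      using \<open>0 \<le> A\<close> by (simp add: K_def ennreal_mult ennreal_of_nat_eq_real_of_nat mult.assoc)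
    finally have "ennreal_pow (\<integral>\<^sup>+x. ennreal_pow (M_tube f x) p \<partial>lborel) (1 / p) \<le>
        ennreal_pow (ennreal (K * A) * ?N) (1 / p)"
      using \<open>1 < p\<close> by (intro ennreal_pow_mono) auto
    also have "\<dots> = ennreal ((K * A) powr (1 / p)) * ennreal_pow ?N (1 / p)"
      using \<open>1 < p\<close> \<open>0 \<le> A\<close> \<open>0 \<le> K\<close> by (intro ennreal_pow_cmult) auto
    also have "?N = (\<integral>\<^sup>+x. ennreal_pow (ennreal (norm (f x))) p \<partial>lborel)"
      using eq by (intro nn_integral_cong_AE, eventually_elim) (simp only:)
    finally show "Lp_norm p (M_tube f) \<le>
        ennreal ((K * A) powr (1 / p)) * Lp_norm p (\<lambda>x. ennreal (norm (f x)))"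
      by (simp add: Lp_norm_def nn_integral_completion)
  qed simp
qed

end
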